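(* Let $q\ge1$, let $A=(a_1,\ldots,a_q)$, $B=(b_1,\ldots,b_q)$ be real vectors with $B\prec^W A$, and let $0<\sigma\le2$. Then the function $$ z\mapsto z\,{}_{q+1}F_q(\sigma,A;B;z) $$ is univalent in the disk $|z|<r_s:=\sqrt{\sqrt{32}-5}\approx0.81$.
   Context: $B\prec^W A$ means: $0<a_1\le\cdots\le a_q$, $0<b_1\le\cdots\le b_q$, and $\sum_{i=1}^{k}a_i\le\sum_{i=1}^{k}b_i$ for $k=1,\ldots,q$. The generalized hypergeometric function is ${}_{q+1}F_q(\sigma,A;B;z)=\sum_{n=0}^{\infty}\frac{(\sigma)_n(a_1)_n\cdots(a_q)_n}{(b_1)_n\cdots(b_q)_n\,n!}z^n$ for $|z|<1$, extended by analytic continuation to $\mathbb{C}\setminus[1,\infty)$; $(a)_0=1$, $(a)_n=a(a+1)\cdots(a+n-1)$. Univalent means holomorphic and injective. *)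

theory Defs
  imports "HOL-Complex_Analysis.Complex_Analysis"
begin

text \<open>
  \<open>weakly_supermajorized B A\<close> renders \<open>B \<prec>\<^sup>W A\<close>.  Lists are indexed from 0, so the
  \<open>k\<close>-th partial sum runs over the indices \<open>i < k\<close>.
\<close>

definition weakly_supermajorized :: "real list \<Rightarrow> real list \<Rightarrow> bool" where
  "weakly_supermajorized B A \<longleftrightarrow>
     length B = length A \<and>
     (\<forall>a\<in>set A. 0 < a) \<and> sorted A \<and>
     (\<forall>b\<in>set B. 0 < b) \<and> sorted B \<and>
     (\<forall>k\<in>{1..length A}. (\<Sum>i<k. A ! i) \<le> (\<Sum>i<k. B ! i))"

text \<open>
  The generalized hypergeometric function with numerator parameters \<open>as\<close> and denominator
  parameters \<open>bs\<close>, in the balanced case \<open>length as = length bs + 1\<close>: the sum of its series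
  in the open unit disk and the analytic continuation of that sum on the rest of the plane
  cut along \<open>[1, \<infinity>)\<close>.  The cut plane is connected, so the continuation is unique there;
  on the cut itself the value is unspecified.
\<close>

definition hypergeometric :: "complex list \<Rightarrow> complex list \<Rightarrow> complex \<Rightarrow> complex" where
  "hypergeometric as bs z =
     (if norm z < 1 then eval_fps (fps_hypergeo as bs 1) z
      else (SOME f. f holomorphic_on (- (complex_of_real ` {1..})) \<and>
              (\<forall>w\<in>ball 0 1. f w = eval_fps (fps_hypergeo as bs 1) w)) z)"

definition univalent_on :: "(complex \<Rightarrow> complex) \<Rightarrow> complex set \<Rightarrow> bool" where
  "univalent_on f S \<longleftrightarrow> f holomorphic_on S \<and> inj_on f S"

end

theory Submission
  imports Defs
begin

text \<open>
  The coefficients of the hypergeometric series are \<open>(n + 1) * m n\<close>, where \<open>m\<close> is the product of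
  the quotients of Pochhammer symbols \<open>(\<sigma>)\<^sub>n / (2)\<^sub>n\<close> and \<open>(a\<^sub>i)\<^sub>n / (b\<^sub>i)\<^sub>n\<close>. By weak majorization
  \<open>m\<close> is a moment sequence on \<open>[0, 1]\<close>, so the function is a mixture of the functions
  \<open>z / (1 - t z)\<^sup>2\<close> with \<open>0 \<le> t \<le> 1\<close>. Injectivity follows if, for \<open>z \<noteq> z'\<close>, the differences
  \<open>z / (1 - t z)\<^sup>2 - z' / (1 - t z')\<^sup>2\<close> all lie in one convex set that omits \<open>0\<close>. For \<open>z\<close> and \<open>z'\<close> on
  opposite sides of the real axis this is a half plane, since each function is typically real. For
  \<open>z\<close> and \<open>z'\<close> in the closed upper half plane, the quotient of the difference by \<open>z - z'\<close> is a
  positive real or has positive imaginary part; the given radius is the largest for which this holds.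
\<close>

subsection \<open>Moment sequences\<close>

text \<open>Moments of finitely supported probability measures on [0, 1]. Mixing two at a time lets
  rule induction reduce claims to point masses.\<close>

inductive_set power_hull :: "(nat \<Rightarrow> real) set" where
  power: "0 \<le> t \<Longrightarrow> t \<le> 1 \<Longrightarrow> (\<lambda>n. t ^ n) \<in> power_hull"
| mix: "f \<in> power_hull \<Longrightarrow> g \<in> power_hull \<Longrightarrow> 0 \<le> u \<Longrightarrow> u \<le> 1 \<Longrightarrow>
    (\<lambda>n. u * f n + (1 - u) * g n) \<in> power_hull"

text \<open>Moment sequences of probability measures on \<open>[0, 1]\<close>, encoded without measures as pointwise
  limits of moment sequences of finitely supported ones.\<close>

definition moment_sequences :: "(nat \<Rightarrow> real) set" where
  "moment_sequences =
     {m. \<exists>h. (\<forall>k. h k \<in> power_hull) \<and> (\<forall>n. (\<lambda>k. h k n) \<longlonglongrightarrow> m n)}"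

lemma power_hull_bounds: "f \<in> power_hull \<Longrightarrow> 0 \<le> f n \<and> f n \<le> 1"
proof (induction rule: power_hull.induct)
  case (power t)
  then show ?case by (simp add: power_le_one)
next
  case (mix f g u)
  then show ?case using convex_bound_le[of "f n" 1 "g n" u "1 - u"] by simp
qed

text \<open>Moments of a product of independent variables multiply: point masses at \<open>t\<close>
  and \<open>s\<close> give one at \<open>t * s\<close>, and the product is linear in each
  factor.\<close>

lemma power_hull_mult:
  assumes "f \<in> power_hull" and "g \<in> power_hull"
  shows "(\<lambda>n. f n * g n) \<in> power_hull"
  using assms
proof (induction rule: power_hull.induct)
  case (power t)
  from power(3) show ?case
  proof (induction rule: power_hull.induct)
    case (power s)
    have "(\<lambda>n. (t * s) ^ n) \<in> power_hull"
      using power \<open>0 \<le> t\<close> \<open>t \<le> 1\<close> by (intro power_hull.power) (auto intro: mult_le_one)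
    then show ?case unfolding power_mult_distrib .
  next
    case (mix f g u)
    then show ?case
      using power_hull.mix[OF mix.IH mix(3,4)] by (simp add: algebra_simps)
  qed
next
  case (mix f1 f2 u)
  then show ?case
    using power_hull.mix[of "\<lambda>n. f1 n * g n" "\<lambda>n. f2 n * g n" u] by (simp add: algebra_simps)
qed

lemma power_hull_one: "(\<lambda>n. 1) \<in> power_hull"
proof -
  have "(\<lambda>n. 1 ^ n) \<in> power_hull" by (rule power_hull.power) auto
  then show ?thesis unfolding power_one .
qed

lemma power_hull_power: "f \<in> power_hull \<Longrightarrow> (\<lambda>n. f n ^ k) \<in> power_hull"
proof (induction k)
  case 0
  then show ?case using power_hull_one by simp
next
  case (Suc k)
  then show ?case using power_hull_mult[of f "\<lambda>n. f n ^ k"] by simp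
qed

lemma power_hull_subset: "f \<in> power_hull \<Longrightarrow> f \<in> moment_sequences"
  unfolding moment_sequences_def by (auto intro!: exI[of _ "\<lambda>_. f"])

lemma moment_sequences_bounds:
  assumes "m \<in> moment_sequences"
  shows "0 \<le> m n" and "m n \<le> 1"
proof -
  from assms obtain h where h: "\<And>k. h k \<in> power_hull" and l: "\<And>n. (\<lambda>k. h k n) \<longlonglongrightarrow> m n"
    unfolding moment_sequences_def by auto
  show "0 \<le> m n" "m n \<le> 1"
    using power_hull_bounds[OF h] LIMSEQ_le_const[OF l] LIMSEQ_le_const2[OF l] by blast+
qed

lemma moment_sequences_mult:
  assumes "f \<in> moment_sequences" and "g \<in> moment_sequences"
  shows "(\<lambda>n. f n * g n) \<in> moment_sequences"
proof -
  from assms obtain h h' where "\<And>k. h k \<in> power_hull" "\<And>n. (\<lambda>k. h k n) \<longlonglongrightarrow> f n"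
      "\<And>k. h' k \<in> power_hull" "\<And>n. (\<lambda>k. h' k n) \<longlonglongrightarrow> g n"
    unfolding moment_sequences_def by auto
  then show ?thesis
    unfolding moment_sequences_def
    by (auto intro!: exI[of _ "\<lambda>k n. h k n * h' k n"] power_hull_mult tendsto_mult)
qed

lemma moment_sequences_one: "(\<lambda>n. 1) \<in> moment_sequences"
  using power_hull_subset[OF power_hull_one] .

lemma moment_sequences_prod:
  fixes N :: nat
  assumes "\<And>i. i < N \<Longrightarrow> f i \<in> moment_sequences"
  shows "(\<lambda>n. \<Prod>i<N. f i n) \<in> moment_sequences"
  using assms
proof (induction N)
  case 0
  then show ?case using moment_sequences_one by simp
next
  case (Suc N)
  then show ?case using moment_sequences_mult[of "\<lambda>n. \<Prod>i<N. f i n" "f N"] by simp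
qed

text \<open>Diagonal choice: \<open>g k\<close> approximates \<open>f k\<close> within
  \<open>1 / Suc k\<close> on the first \<open>k + 1\<close> entries, so a single sequence in
  \<open>power_hull\<close> reaches the limit.\<close>

lemma moment_sequences_limit:
  assumes f: "\<And>k. f k \<in> moment_sequences" and lim: "\<And>n. (\<lambda>k. f k n) \<longlonglongrightarrow> m n"
  shows "m \<in> moment_sequences"
proof -
  have "\<exists>g\<in>power_hull. \<forall>n\<le>k. \<bar>g n - f k n\<bar> < 1 / real (Suc k)" for k
  proof -
    obtain h where h: "\<And>j. h j \<in> power_hull" and l: "\<And>n. (\<lambda>j. h j n) \<longlonglongrightarrow> f k n"
      using f[of k] unfolding moment_sequences_def by auto
    have "\<forall>\<^sub>F j in sequentially. \<forall>n\<in>{..k}. \<bar>h j n - f k n\<bar> < 1 / real (Suc k)"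
    proof (intro eventually_ball_finite ballI)
      fix n
      show "\<forall>\<^sub>F j in sequentially. \<bar>h j n - f k n\<bar> < 1 / real (Suc k)"
        using tendstoD[OF l[of n], of "1 / real (Suc k)"] by (simp add: dist_real_def)
    qed simp
    then obtain j where "\<forall>n\<in>{..k}. \<bar>h j n - f k n\<bar> < 1 / real (Suc k)"
      using eventually_happens' sequentially_bot by blast
    then show ?thesis using h by blast
  qed
  then obtain g where g: "\<And>k. g k \<in> power_hull"
      and gf: "\<And>k n. n \<le> k \<Longrightarrow> \<bar>g k n - f k n\<bar> < 1 / real (Suc k)"
    by metis
  have "(\<lambda>k. g k n) \<longlonglongrightarrow> m n" for n
  proof -
    have "(\<lambda>k. g k n - f k n) \<longlonglongrightarrow> 0"
    proof (rule Lim_null_comparison[OF _ LIMSEQ_inverse_real_of_nat])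
      show "\<forall>\<^sub>F k in sequentially. norm (g k n - f k n) \<le> inverse (real (Suc k))"
        using eventually_ge_at_top[of n] by eventually_elim (use gf in \<open>force simp: inverse_eq_divide\<close>)
    qed
    from tendsto_add[OF this lim[of n]] show ?thesis by simp
  qed
  then show ?thesis using g unfolding moment_sequences_def by auto
qed

text \<open>These are the moments of \<open>s\<close> raised to a Poisson variable, a limit of binomial ones.\<close>

lemma moment_sequences_exp:
  assumes "0 \<le> w" "0 \<le> s" "s \<le> 1"
  shows "(\<lambda>n. exp (- (w * (1 - s ^ n)))) \<in> moment_sequences"
proof (rule moment_sequences_limit)
  \<comment> \<open>\<open>N k\<close> is at least \<open>w\<close>, so that the weight
    \<open>u k\<close> below lies in [0, 1].\<close>
  define N where "N k = nat \<lceil>w\<rceil> + Suc k" for k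
  have N: "w \<le> real (N k)" "0 < N k" for k
    unfolding N_def by linarith+
  have top: "filterlim N at_top sequentially"
    unfolding N_def by (rule filterlim_at_top_mono[OF filterlim_Suc]) auto
  define u where "u k = 1 - w / real (N k)" for k
  have "(\<lambda>n. u k * 1 ^ n + (1 - u k) * s ^ n) \<in> power_hull" for k
    by (rule power_hull.mix[OF power_hull.power power_hull.power])
      (use assms N[of k] in \<open>auto simp: u_def field_simps\<close>)
  from power_hull_subset[OF power_hull_power[OF this]]
  show "(\<lambda>n. (u k * 1 ^ n + (1 - u k) * s ^ n) ^ N k) \<in> moment_sequences" for k .
  show "(\<lambda>k. (u k * 1 ^ n + (1 - u k) * s ^ n) ^ N k) \<longlonglongrightarrow> exp (- (w * (1 - s ^ n)))" for n
  proof -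
    have "u k * 1 ^ n + (1 - u k) * s ^ n = 1 + - (w * (1 - s ^ n)) / real (N k)" for k
      using N(2)[of k] by (simp add: u_def field_simps)
    then show ?thesis
      using filterlim_compose[OF tendsto_exp_limit_sequentially[of "- (w * (1 - s ^ n))"] top] by simp
  qed
qed

subsection \<open>Pochhammer quotients\<close>

lemma weighted_sum_nonneg_by_parts:
  fixes c d :: "nat \<Rightarrow> real"
  assumes "\<And>i j. i \<le> j \<Longrightarrow> j < q \<Longrightarrow> c j \<le> c i" and "\<And>i. i < q \<Longrightarrow> 0 \<le> c i"
    and "\<And>k. k \<le> q \<Longrightarrow> 0 \<le> (\<Sum>i<k. d i)"
  shows "0 \<le> (\<Sum>i<q. c i * d i)"
proof -
  \<comment> \<open>Abel summation as an induction: passing to the next, smaller weight only lowers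
    the left side, since the plain partial sum is nonnegative.\<close>
  have partial: "c k * (\<Sum>i<Suc k. d i) \<le> (\<Sum>i<Suc k. c i * d i)" if "Suc k \<le> q" for k
    using that
  proof (induction k)
    case (Suc k)
    have "c (Suc k) * (\<Sum>i<Suc k. d i) \<le> c k * (\<Sum>i<Suc k. d i)"
      using assms(1)[of k "Suc k"] assms(3)[of "Suc k"] Suc.prems by (intro mult_right_mono) auto
    with Suc show ?case
      by (simp add: algebra_simps)
  qed simp
  show ?thesis
  proof (cases q)
    case (Suc k)
    have "0 \<le> c k * (\<Sum>i<Suc k. d i)"
      using assms(2)[of k] assms(3)[of "Suc k"] Suc by (intro mult_nonneg_nonneg) auto
    also have "\<dots> \<le> (\<Sum>i<q. c i * d i)" using partial[of k] Suc by simp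
    finally show ?thesis .
  qed simp
qed

text \<open>Convexity bounds each difference by the tangent at \<open>b i\<close>; then sum by parts.\<close>

lemma sum_exp_majorization:
  fixes a b :: "nat \<Rightarrow> real"
  assumes b: "\<And>i j. i \<le> j \<Longrightarrow> j < q \<Longrightarrow> b i \<le> b j"
    and ab: "\<And>k. k \<le> q \<Longrightarrow> (\<Sum>i<k. a i) \<le> (\<Sum>i<k. b i)" and "0 \<le> \<tau>"
  shows "(\<Sum>i<q. exp (- (\<tau> * b i))) \<le> (\<Sum>i<q. exp (- (\<tau> * a i)))"
proof -
  have "0 \<le> (\<Sum>i<q. \<tau> * exp (- (\<tau> * b i)) * (b i - a i))"
    using ab b \<open>0 \<le> \<tau>\<close>
    by (intro weighted_sum_nonneg_by_parts) (auto simp: sum_subtractf intro!: mult_left_mono)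
  also have "\<dots> \<le> (\<Sum>i<q. exp (- (\<tau> * a i)) - exp (- (\<tau> * b i)))"
  proof (rule sum_mono)
    fix i
    have "exp (- (\<tau> * b i)) * (1 + \<tau> * (b i - a i)) \<le> exp (- (\<tau> * b i)) * exp (\<tau> * (b i - a i))"
      by (intro mult_left_mono) auto
    also have "\<dots> = exp (- (\<tau> * a i))"
      by (simp add: exp_add[symmetric] algebra_simps)
    finally show "\<tau> * exp (- (\<tau> * b i)) * (b i - a i) \<le> exp (- (\<tau> * a i)) - exp (- (\<tau> * b i))"
      by (simp add: algebra_simps)
  qed
  finally show ?thesis by (simp add: sum_subtractf)
qed

text \<open>The logarithm of the \<open>q\<close>-analogue of a Pochhammer quotient, with base \<open>exp (- h)\<close>, is a
  series of terms \<open>- w j * (1 - (exp (- h) ^ j) ^ n)\<close>, and weak majorization makes \<open>w j\<close>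
  nonnegative. The term \<open>j = 0\<close> vanishes because \<open>1 / 0 = 0\<close>.\<close>

lemma q_pochhammer_quotient_moments:
  fixes a b :: "nat \<Rightarrow> real" and h :: real
  assumes b: "\<And>i j. i \<le> j \<Longrightarrow> j < q \<Longrightarrow> b i \<le> b j"
    and ab: "\<And>k. k \<le> q \<Longrightarrow> (\<Sum>i<k. a i) \<le> (\<Sum>i<k. b i)"
    and pos: "\<And>i. i < q \<Longrightarrow> 0 < a i" "\<And>i. i < q \<Longrightarrow> 0 < b i" and h: "0 < h"
  shows "(\<lambda>n. \<Prod>i<q. \<Prod>k<n. (1 - exp (- (h * (a i + real k)))) / (1 - exp (- (h * (b i + real k)))))
    \<in> moment_sequences"
proof (rule moment_sequences_limit)
  define s where "s = exp (- h)"
  define d where "d j = (\<Sum>i<q. exp (- (j * h * a i)) - exp (- (j * h * b i)))" for j :: real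
  \<comment> \<open>The factor \<open>1 / j\<close> comes from the logarithm series,
    \<open>1 / (1 - s ^ j)\<close> from the geometric sum over \<open>k < n\<close>.\<close>
  define w where "w j = d (real j) / (real j * (1 - s ^ j))" for j
  have s: "0 < s" "s < 1" using h by (auto simp: s_def)
  have w0: "0 \<le> w j" for j
  proof -
    have "0 \<le> d (real j)"
      unfolding d_def sum_subtractf diff_ge_0_iff_ge
      by (rule sum_exp_majorization) (use b ab h in auto)
    then show ?thesis
      unfolding w_def using s by (intro divide_nonneg_nonneg mult_nonneg_nonneg) (auto simp: power_le_one)
  qed
  show "(\<lambda>n. \<Prod>j<J. exp (- (w j * (1 - (s ^ j) ^ n)))) \<in> moment_sequences" for J
    using w0 s by (intro moment_sequences_prod moment_sequences_exp) (auto simp: power_le_one)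
  fix n
  have ser: "(\<lambda>j. - (exp (- (real j * h * (x + real k))) / real j)) sums ln (1 - exp (- (h * (x + real k))))"
    if "0 < x" for x k
    using ln_series'[of "- exp (- (h * (x + real k)))"] that h
    by (simp add: add_pos_nonneg exp_of_nat_mult[symmetric] mult.assoc)
  have "(\<lambda>j. \<Sum>i<q. \<Sum>k<n. - (exp (- (real j * h * (a i + real k))) / real j)
               - - (exp (- (real j * h * (b i + real k))) / real j))
     sums (\<Sum>i<q. \<Sum>k<n. ln (1 - exp (- (h * (a i + real k)))) - ln (1 - exp (- (h * (b i + real k)))))"
    using pos by (intro sums_sum sums_diff ser) auto
  moreover have "(\<Sum>i<q. \<Sum>k<n. - (exp (- (real j * h * (a i + real k))) / real j)
               - - (exp (- (real j * h * (b i + real k))) / real j)) = - (w j * (1 - (s ^ j) ^ n))" for j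
  proof (cases "j = 0")
    case True
    then show ?thesis by (simp add: w_def)
  next
    case False
    then have sj: "s ^ j < 1" using s power_strict_decreasing[of 0 j s] by simp
    have e: "exp (- (real j * h * (x + real k))) = exp (- (real j * h * x)) * (s ^ j) ^ k" for x k
      by (simp add: s_def exp_of_nat_mult[symmetric] exp_add[symmetric] algebra_simps)
    have "(\<Sum>i<q. \<Sum>k<n. - (exp (- (real j * h * (a i + real k))) / real j)
               - - (exp (- (real j * h * (b i + real k))) / real j)) =
        (\<Sum>i<q. \<Sum>k<n. - ((exp (- (real j * h * a i)) - exp (- (real j * h * b i))) / real j) * (s ^ j) ^ k)"
      unfolding e by (simp add: field_simps diff_divide_distrib)
    also have "\<dots> = - (d (real j) / real j) * (\<Sum>k<n. (s ^ j) ^ k)"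
      unfolding sum_distrib_left[symmetric] sum_distrib_right[symmetric] d_def
      by (simp add: sum_negf sum_divide_distrib)
    also have "\<dots> = - (w j * (1 - (s ^ j) ^ n))"
      using sj by (simp add: sum_gp_strict w_def)
    finally show ?thesis .
  qed
  ultimately have "(\<lambda>j. - (w j * (1 - (s ^ j) ^ n))) sums
      (\<Sum>i<q. \<Sum>k<n. ln (1 - exp (- (h * (a i + real k)))) - ln (1 - exp (- (h * (b i + real k)))))"
    by simp
  then have "(\<lambda>J. exp (\<Sum>j<J. - (w j * (1 - (s ^ j) ^ n)))) \<longlonglongrightarrow>
      exp (\<Sum>i<q. \<Sum>k<n. ln (1 - exp (- (h * (a i + real k)))) - ln (1 - exp (- (h * (b i + real k)))))"
    unfolding sums_def by (rule tendsto_exp)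
  moreover have "exp (ln (1 - exp (- (h * (a i + real k)))) - ln (1 - exp (- (h * (b i + real k))))) =
      (1 - exp (- (h * (a i + real k)))) / (1 - exp (- (h * (b i + real k))))" if "i < q" for i k
    using pos[OF that] h by (simp add: exp_diff add_pos_nonneg)
  ultimately show "(\<lambda>J. \<Prod>j<J. exp (- (w j * (1 - (s ^ j) ^ n)))) \<longlonglongrightarrow>
     (\<Prod>i<q. \<Prod>k<n. (1 - exp (- (h * (a i + real k)))) / (1 - exp (- (h * (b i + real k)))))"
    by (simp add: exp_sum)
qed

text \<open>Let the base \<open>exp (- h)\<close> of the \<open>q\<close>-analogue tend to 1 along
  \<open>h = 1 / Suc N\<close>; each factor then tends to
  \<open>(a i + k) / (b i + k)\<close>.\<close>

lemma pochhammer_quotient_moments: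
  fixes a b :: "nat \<Rightarrow> real"
  assumes b: "\<And>i j. i \<le> j \<Longrightarrow> j < q \<Longrightarrow> b i \<le> b j"
    and ab: "\<And>k. k \<le> q \<Longrightarrow> (\<Sum>i<k. a i) \<le> (\<Sum>i<k. b i)"
    and pos: "\<And>i. i < q \<Longrightarrow> 0 < a i" "\<And>i. i < q \<Longrightarrow> 0 < b i"
  shows "(\<lambda>n. \<Prod>i<q. pochhammer (a i) n / pochhammer (b i) n) \<in> moment_sequences"
proof (rule moment_sequences_limit)
  show "(\<lambda>n. \<Prod>i<q. \<Prod>k<n. (1 - exp (- (1 / real (Suc N) * (a i + real k)))) /
      (1 - exp (- (1 / real (Suc N) * (b i + real k))))) \<in> moment_sequences" for N
    by (rule q_pochhammer_quotient_moments) (use b ab pos in auto)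
  fix n
  have d: "((\<lambda>h. (1 - exp (- (h * x))) / h) \<longlongrightarrow> x) (at (0::real))" for x :: real
  proof -
    have "((\<lambda>h. 1 - exp (- (h * x))) has_real_derivative x) (at 0)"
      by (auto intro!: derivative_eq_intros)
    then show ?thesis by (simp add: has_field_derivative_iff)
  qed
  have lim0: "(\<lambda>N. 1 / real (Suc N)) \<longlonglongrightarrow> 0"
    using LIMSEQ_inverse_real_of_nat by (simp add: inverse_eq_divide)
  have at0: "filterlim (\<lambda>N. 1 / real (Suc N)) (at 0) sequentially"
    unfolding filterlim_at using lim0 by auto
  have lim: "(\<lambda>N. (1 - exp (- (1 / real (Suc N) * x))) / (1 - exp (- (1 / real (Suc N) * y)))) \<longlonglongrightarrow> x / y"
    if "0 < y" for x y
  proof -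
    have "((\<lambda>h. ((1 - exp (- (h * x))) / h) / ((1 - exp (- (h * y))) / h)) \<longlongrightarrow> x / y) (at (0::real))"
      using that by (intro tendsto_divide d) auto
    from filterlim_compose[OF this at0] show ?thesis by simp
  qed
  have "(\<lambda>N. \<Prod>i<q. \<Prod>k<n. (1 - exp (- (1 / real (Suc N) * (a i + real k)))) /
      (1 - exp (- (1 / real (Suc N) * (b i + real k))))) \<longlonglongrightarrow>
      (\<Prod>i<q. \<Prod>k<n. (a i + real k) / (b i + real k))"
    by (intro tendsto_prod lim) (use pos(2) in \<open>auto intro: add_pos_nonneg\<close>)
  then show "(\<lambda>N. \<Prod>i<q. \<Prod>k<n. (1 - exp (- (1 / real (Suc N) * (a i + real k)))) /
      (1 - exp (- (1 / real (Suc N) * (b i + real k))))) \<longlonglongrightarrow>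
      (\<Prod>i<q. pochhammer (a i) n / pochhammer (b i) n)"
    by (simp add: pochhammer_prod atLeast0LessThan prod_dividef)
qed

subsection \<open>The kernel on the upper half disk\<close>

text \<open>The imaginary part of \<open>v * v' * (v + v' - 1)\<close> for \<open>v = x + i y\<close> and \<open>v' = x' + i y'\<close>.\<close>

definition kernel_im :: "real \<Rightarrow> real \<Rightarrow> real \<Rightarrow> real \<Rightarrow> real" where
  "kernel_im x y x' y' = (x * y' + x' * y) * (x + x' - 1) + (x * x' - y * y') * (y + y')"

lemma kernel_im_commute: "kernel_im x y x' y' = kernel_im x' y' x y"
  by (simp add: kernel_im_def algebra_simps)

text \<open>The condition on \<open>C\<close> makes the discriminant of the quadratic in \<open>x\<close> vanish for \<open>c = 1\<close>; with
  \<open>C = 1 / (1 - r\<^sup>2)\<close> it determines the radius \<open>r\<close>.\<close>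

lemma circle_quadratic_nonneg:
  fixes x c C \<rho> :: real
  assumes C: "6 * C - 1 = 4 * sqrt 2 * C" "1 \<le> C" and \<rho>: "\<rho>\<^sup>2 = C\<^sup>2 - C" "0 \<le> \<rho>"
    and c: "\<bar>x\<bar> \<le> c" "c \<le> 1"
  shows "0 \<le> c * C * (3 * C - 1) + x * \<rho> * (4 * C * c\<^sup>2 + 2 * C - 1) + \<rho>\<^sup>2 * c * (4 * x\<^sup>2 - 1)"
proof -
  have "\<rho>\<^sup>2 \<le> C\<^sup>2" using \<rho> C by simp
  then have \<rho>C: "\<rho> \<le> C" using C(2) power2_le_imp_le by fastforce
  \<comment> \<open>Eliminating \<open>\<rho>\<^sup>2 = C\<^sup>2 - C\<close> from the constant
    terms leaves only the middle term with the sign of \<open>x\<close>.\<close>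
  have eq: "c * C * (3 * C - 1) + x * \<rho> * (4 * C * c\<^sup>2 + 2 * C - 1) + \<rho>\<^sup>2 * c * (4 * x\<^sup>2 - 1) =
    2 * c * C\<^sup>2 + x * \<rho> * (4 * C * c\<^sup>2 + 2 * C - 1) + 4 * \<rho>\<^sup>2 * c * x\<^sup>2" (is "?G = ?G'")
    using \<rho>(1) by algebra
  show ?thesis
  proof (cases "x < 0")
    case False
    have "0 \<le> 4 * C * c\<^sup>2" using C by simp
    then have "0 \<le> 4 * C * c\<^sup>2 + 2 * C - 1" using C by linarith
    with False C \<rho>(2) c show ?thesis unfolding eq
      by (intro add_nonneg_nonneg mult_nonneg_nonneg) auto
  next
    case True
    define X where "X = - x"
    have X: "0 < X" "X \<le> c" "0 < c" using True c by (auto simp: X_def)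
    define k where "k = sqrt (2::real)"
    have k: "k\<^sup>2 = 2" by (simp add: k_def)
    \<comment> \<open>The condition on \<open>C\<close> matches the cross terms when the square is
      completed. The remainder vanishes at \<open>c = 1\<close> and is nonnegative because
      \<open>X \<le> c \<le> 1\<close> and \<open>\<rho> \<le> C\<close>.\<close>
    have "c * ?G' = 2 * (C * c - k * \<rho> * X)\<^sup>2 + 4 * \<rho> * X * ((1 - c\<^sup>2) * (C * c - \<rho> * X))"
    proof -
      have "c * ?G' - (2 * (C * c - k * \<rho> * X)\<^sup>2 + 4 * \<rho> * X * ((1 - c\<^sup>2) * (C * c - \<rho> * X))) =
          \<rho> * X * c * (4 * k * C - (6 * C - 1)) + 2 * (2 - k\<^sup>2) * \<rho>\<^sup>2 * X\<^sup>2"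
        unfolding X_def by (simp add: power2_eq_square algebra_simps)
      then show ?thesis using k C(1)[folded k_def] by simp
    qed
    also have "\<dots> \<ge> 0"
      using \<rho> X c \<rho>C C mult_mono[of \<rho> C X c]
      by (intro add_nonneg_nonneg mult_nonneg_nonneg) (auto simp: power_le_one)
    finally show ?thesis unfolding eq using X(3) by (simp add: zero_le_mult_iff)
  qed
qed

text \<open>The circle with centre \<open>C\<close> and radius \<open>\<rho>\<close> is
  \<open>\<bar>v\<bar>\<^sup>2 = C * (2 * Re v - 1)\<close>, the image of
  \<open>\<bar>w\<bar> = r\<close> under \<open>v = 1 / (1 - w)\<close>.\<close>

lemma kernel_im_circle_polar:
  fixes C \<rho> \<phi> \<phi>' :: real
  assumes C: "6 * C - 1 = 4 * sqrt 2 * C" "1 \<le> C" and \<rho>: "\<rho>\<^sup>2 = C\<^sup>2 - C" "0 \<le> \<rho>"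
    and \<phi>: "0 \<le> \<phi>" "\<phi> \<le> pi" "0 \<le> \<phi>'" "\<phi>' \<le> pi"
  shows "0 \<le> kernel_im (C + \<rho> * cos \<phi>) (\<rho> * sin \<phi>) (C + \<rho> * cos \<phi>') (\<rho> * sin \<phi>')"
proof -
  \<comment> \<open>In the half sum and half difference of the angles the expression factors.\<close>
  define \<alpha> \<delta> where "\<alpha> = (\<phi> + \<phi>') / 2" and "\<delta> = (\<phi> - \<phi>') / 2"
  define x s c d where "x = cos \<alpha>" and "s = sin \<alpha>" and "c = cos \<delta>" and "d = sin \<delta>"
  have p: "\<phi> = \<alpha> + \<delta>" "\<phi>' = \<alpha> - \<delta>" by (auto simp: \<alpha>_def \<delta>_def field_simps)
  have sq: "s\<^sup>2 = 1 - x\<^sup>2" "d\<^sup>2 = 1 - c\<^sup>2"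
    by (auto simp: x_def s_def c_def d_def sin_squared_eq)
  have "0 \<le> s" unfolding s_def \<alpha>_def using \<phi> by (intro sin_ge_zero) auto
  have "0 \<le> c" unfolding c_def \<delta>_def using \<phi> by (intro cos_ge_zero) auto
  \<comment> \<open>That both points lie in the closed upper half plane becomes the range
    \<open>\<bar>x\<bar> \<le> c\<close> required by the quadratic estimate.\<close>
  have "0 \<le> sin \<phi> * sin \<phi>'" using \<phi> by (simp add: sin_ge_zero)
  also have "sin \<phi> * sin \<phi>' = c\<^sup>2 - x\<^sup>2"
    unfolding p sin_add sin_diff x_def[symmetric] s_def[symmetric] c_def[symmetric] d_def[symmetric]
    using sq by algebra
  finally have "\<bar>x\<bar> \<le> c" using \<open>0 \<le> c\<close> abs_le_square_iff[of x c] by simp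
  have "kernel_im (C + \<rho> * cos \<phi>) (\<rho> * sin \<phi>) (C + \<rho> * cos \<phi>') (\<rho> * sin \<phi>') =
     2 * \<rho> * s * (c * C * (3 * C - 1) + x * \<rho> * (4 * C * c\<^sup>2 + 2 * C - 1) + \<rho>\<^sup>2 * c * (4 * x\<^sup>2 - 1))"
    unfolding p sin_add sin_diff cos_add cos_diff kernel_im_def
      x_def[symmetric] s_def[symmetric] c_def[symmetric] d_def[symmetric]
    using sq \<rho>(1) by algebra
  also have "\<dots> \<ge> 0"
    using \<rho>(2) \<open>0 \<le> s\<close> circle_quadratic_nonneg[OF C \<rho> \<open>\<bar>x\<bar> \<le> c\<close>]
    by (intro mult_nonneg_nonneg) (auto simp: c_def)
  finally show ?thesis .
qed

lemma upper_circle_polar: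
  fixes x y C \<rho> :: real
  assumes "(x - C)\<^sup>2 + y\<^sup>2 = \<rho>\<^sup>2" "0 < \<rho>" "0 \<le> y"
  obtains \<phi> where "0 \<le> \<phi>" "\<phi> \<le> pi" "x = C + \<rho> * cos \<phi>" "y = \<rho> * sin \<phi>"
proof
  let ?c = "(x - C) / \<rho>"
  have "?c\<^sup>2 \<le> 1" using assms by (simp add: power_divide)
      (metis le_add_same_cancel1 zero_le_power2)
  then have "\<bar>?c\<bar> \<le> 1" by (simp only: abs_square_le_1)
  then have c: "-1 \<le> ?c" "?c \<le> 1" by linarith+
  show "0 \<le> arccos ?c" "arccos ?c \<le> pi" using c by (auto intro: arccos_lbound arccos_ubound)
  show "x = C + \<rho> * cos (arccos ?c)" using c assms(2) by simp
  have "(\<rho> * sin (arccos ?c))\<^sup>2 = y\<^sup>2"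
    using c assms(1,2) by (simp add: power_mult_distrib sin_squared_eq right_diff_distrib power_divide)
  moreover have "0 \<le> \<rho> * sin (arccos ?c)"
    using assms(2) c by (intro mult_nonneg_nonneg sin_ge_zero arccos_lbound arccos_ubound) auto
  ultimately show "y = \<rho> * sin (arccos ?c)"
    using assms(3) by (metis power2_eq_imp_eq)
qed

lemma kernel_im_circle_nonneg:
  fixes C :: real
  assumes C: "6 * C - 1 = 4 * sqrt 2 * C" "1 < C"
    and "x\<^sup>2 + y\<^sup>2 = C * (2 * x - 1)" "x'\<^sup>2 + y'\<^sup>2 = C * (2 * x' - 1)" "0 \<le> y" "0 \<le> y'"
  shows "0 \<le> kernel_im x y x' y'"
proof -
  define \<rho> where "\<rho> = sqrt (C\<^sup>2 - C)"
  have "C < C\<^sup>2" using C(2) by (simp add: power2_eq_square)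
  then have \<rho>: "\<rho>\<^sup>2 = C\<^sup>2 - C" "0 < \<rho>" by (auto simp: \<rho>_def)
  have "(x - C)\<^sup>2 + y\<^sup>2 = \<rho>\<^sup>2" "(x' - C)\<^sup>2 + y'\<^sup>2 = \<rho>\<^sup>2"
    using assms(3,4) \<rho>(1) by (simp_all add: power2_eq_square algebra_simps)
  with assms(5,6) \<rho>(2) obtain \<phi> \<phi>' where
    "0 \<le> \<phi>" "\<phi> \<le> pi" "x = C + \<rho> * cos \<phi>" "y = \<rho> * sin \<phi>"
    "0 \<le> \<phi>'" "\<phi>' \<le> pi" "x' = C + \<rho> * cos \<phi>'" "y' = \<rho> * sin \<phi>'"
    by (metis upper_circle_polar)
  with kernel_im_circle_polar[of C \<rho> \<phi> \<phi>'] C \<rho> show ?thesis by simp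
qed

text \<open>\<open>kernel_im\<close> is concave in each ordinate, so its sign on the half disk is decided on the
  bounding segment and arc.\<close>

lemma kernel_im_concave:
  assumes "0 \<le> y'" "0 \<le> u" "u \<le> 1"
  shows "u * kernel_im x Y x' y' + (1 - u) * kernel_im x 0 x' y' \<le> kernel_im x (u * Y) x' y'"
proof -
  have "kernel_im x (u * Y) x' y' - (u * kernel_im x Y x' y' + (1 - u) * kernel_im x 0 x' y')
    = u * (1 - u) * y' * Y\<^sup>2"
    unfolding kernel_im_def by algebra
  also have "\<dots> \<ge> 0" using assms by simp
  finally show ?thesis by simp
qed

text \<open>Concavity is applied along two vertical chords from the real axis to the circle. The
  value is nonnegative when both points are on the circle and strictly positive when one is on the
  axis and the other above it, which gives strictness.\<close>

lemma kernel_im_pos: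
  fixes C :: real
  assumes C: "6 * C - 1 = 4 * sqrt 2 * C" "1 < C"
    and d: "x\<^sup>2 + y\<^sup>2 < C * (2 * x - 1)" "x'\<^sup>2 + y'\<^sup>2 < C * (2 * x' - 1)"
    and y: "0 \<le> y" "0 \<le> y'" "0 < y \<or> 0 < y'"
  shows "0 < kernel_im x y x' y'"
proof -
  have half: "1 / 2 < x" if "x\<^sup>2 + y\<^sup>2 < C * (2 * x - 1)" for x y
  proof -
    have "0 < C * (2 * x - 1)" using that by (smt (verit) zero_le_power2)
    then show ?thesis using C(2) by (simp add: zero_less_mult_iff)
  qed
  have main: "0 < kernel_im x y x' y'"
    if d: "x\<^sup>2 + y\<^sup>2 < C * (2 * x - 1)" "x'\<^sup>2 + y'\<^sup>2 < C * (2 * x' - 1)" and y: "0 \<le> y" "0 < y'"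
    for x y x' y'
  proof -
    define Y where "Y = sqrt (C * (2 * x - 1) - x\<^sup>2)"
    define Y' where "Y' = sqrt (C * (2 * x' - 1) - x'\<^sup>2)"
    have h: "1/2 < x" "1/2 < x'" using half d by blast+
    have rad: "y\<^sup>2 < C * (2 * x - 1) - x\<^sup>2" "y'\<^sup>2 < C * (2 * x' - 1) - x'\<^sup>2" using d by auto
    have Y: "y < Y" "y' < Y'" "0 < Y" "0 < Y'"
      using rad y unfolding Y_def Y'_def
      by (auto intro!: real_less_rsqrt) (smt (verit) zero_le_power2)+
    have sq: "x\<^sup>2 + Y\<^sup>2 = C * (2 * x - 1)" "x'\<^sup>2 + Y'\<^sup>2 = C * (2 * x' - 1)"
      using rad unfolding Y_def Y'_def by (smt (verit) real_sqrt_pow2 zero_le_power2)+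
    have real: "0 < kernel_im a 0 b z" if "1/2 < a" "1/2 < b" "0 < z" for a b z
    proof -
      have "kernel_im a 0 b z = a * z * ((a + b - 1) + b)" by (simp add: kernel_im_def algebra_simps)
      then show ?thesis using that by simp
    qed
    define u u' where "u = y / Y" and "u' = y' / Y'"
    have u: "0 \<le> u" "u < 1" "y = u * Y" "0 \<le> u'" "u' < 1" "y' = u' * Y'"
      using Y y by (auto simp: u_def u'_def)
    \<comment> \<open>First lower the second point from the circle to height \<open>y'\<close>, with
      the first kept at height \<open>Y\<close>; then lower the first.\<close>
    have "0 \<le> u' * kernel_im x' Y' x Y + (1 - u') * kernel_im x' 0 x Y"
      using kernel_im_circle_nonneg[OF C sq(2,1)] real[OF h(2,1), of Y] Y u
      by (intro add_nonneg_nonneg mult_nonneg_nonneg) auto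
    also have "\<dots> \<le> kernel_im x Y x' y'"
      using kernel_im_concave[of Y u' x' Y' x] Y u by (simp add: kernel_im_commute[of x])
    finally have "0 \<le> kernel_im x Y x' y'" .
    then have "0 < u * kernel_im x Y x' y' + (1 - u) * kernel_im x 0 x' y'"
      using u real[OF h y(2)] by (intro add_nonneg_pos mult_nonneg_nonneg mult_pos_pos) auto
    also have "\<dots> \<le> kernel_im x y x' y'"
      using kernel_im_concave[of y' u x Y x'] u y by simp
    finally show ?thesis .
  qed
  show ?thesis
    using y(3) main[OF d(1,2) y(1)] main[OF d(2,1) y(2)] kernel_im_commute by metis
qed

text \<open>The positive reals are included because the kernel is real for real arguments; the set
  stays convex and omits 0.\<close>

definition upper_slit :: "complex set" where
  "upper_slit = {k. 0 < Im k \<or> Im k = 0 \<and> 0 < Re k}"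

lemma convex_upper_slit: "convex upper_slit"
proof (rule convexI)
  fix k l :: complex and u v :: real
  assume k: "k \<in> upper_slit" and l: "l \<in> upper_slit" and uv: "0 \<le> u" "0 \<le> v" "u + v = 1"
  show "u *\<^sub>R k + v *\<^sub>R l \<in> upper_slit"
  proof (cases "u = 0 \<or> v = 0")
    case True
    then show ?thesis using k l uv by auto
  next
    case False
    then have "0 < u" "0 < v" using uv by auto
    with k l show ?thesis by (auto simp: upper_slit_def add_pos_nonneg add_nonneg_pos add_pos_pos)
  qed
qed

lemma radius_bounds:
  defines "r \<equiv> sqrt (sqrt 32 - 5)"
  shows "r < 1" "r\<^sup>2 = 4 * sqrt 2 - 5"
proof -
  have s: "sqrt 32 = 4 * sqrt 2"
    using real_sqrt_mult[of 16 2] by simp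
  have "5 / 4 < sqrt 2" by (rule real_less_rsqrt) (simp add: power2_eq_square)
  moreover have "sqrt 2 < 3 / 2" by (rule real_less_lsqrt) (simp_all add: power2_eq_square)
  ultimately
  show "r < 1" "r\<^sup>2 = 4 * sqrt 2 - 5" unfolding r_def s by auto
qed

text \<open>With \<open>v = 1 / (1 - w)\<close> and \<open>v' = 1 / (1 - w')\<close>, the kernel is \<open>v * v' * (v + v' - 1)\<close>, and
  \<open>w\<close> in the disk of radius \<open>r\<close> means \<open>\<bar>v\<bar>\<^sup>2 < C * (2 * Re v - 1)\<close> with \<open>C = 1 / (1 - r\<^sup>2)\<close>.\<close>

lemma kernel_in_upper_slit:
  fixes w w' :: complex
  assumes w: "norm w < sqrt (sqrt 32 - 5)" "norm w' < sqrt (sqrt 32 - 5)" "0 \<le> Im w" "0 \<le> Im w'"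
  shows "(1 - w * w') / ((1 - w)\<^sup>2 * (1 - w')\<^sup>2) \<in> upper_slit"
proof -
  \<comment> \<open>This is \<open>1 / (1 - r\<^sup>2) = 1 / (6 - 4 * sqrt 2)\<close> with the
    denominator rationalised.\<close>
  define C :: real where "C = (3 + 2 * sqrt 2) / 2"
  have C: "6 * C - 1 = 4 * sqrt 2 * C" "1 < C" 
    unfolding C_def by (auto simp: algebra_simps add_pos_pos)
  have Cr: "C * (1 - (4 * sqrt 2 - 5)) = 1" by (simp add: C_def algebra_simps)
  define v v' where "v = 1 / (1 - w)" and "v' = 1 / (1 - w')"
  have disk: "(Re v)\<^sup>2 + (Im v)\<^sup>2 < C * (2 * Re v - 1) \<and> 0 \<le> Im v \<and> (Im v = 0 \<longleftrightarrow> Im w = 0) \<and> w \<noteq> 1"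
    if "norm w < sqrt (sqrt 32 - 5)" "0 \<le> Im w" "v = 1 / (1 - w)" for v w
  proof -
    have "(norm w)\<^sup>2 < (sqrt (sqrt 32 - 5))\<^sup>2"
      using that(1) by (intro power_strict_mono) auto
    then have lt: "(norm w)\<^sup>2 < 4 * sqrt 2 - 5" using radius_bounds by simp
    have "w \<noteq> 1" using that(1) radius_bounds(1) by auto
    define D where "D = (1 - Re w)\<^sup>2 + (Im w)\<^sup>2"
    have D_eq: "1 - (norm w)\<^sup>2 = 2 * (1 - Re w) - D"
      by (simp add: D_def cmod_power2 power2_diff)
    have D: "0 < D" using \<open>w \<noteq> 1\<close> by (auto simp: D_def complex_eq_iff sum_power2_gt_zero_iff)
    have v: "Re v = (1 - Re w) / D" "Im v = Im w / D"
      by (simp_all add: that(3) Re_divide Im_divide D_def)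
    have "C * (1 - (4 * sqrt 2 - 5)) < C * (1 - (norm w)\<^sup>2)"
      using lt C(2) by (intro mult_strict_left_mono) auto
    then have "1 < C * (2 * (1 - Re w) - D)" 
      unfolding Cr D_eq .
    then have "1 / D < C * (2 * (1 - Re w) - D) / D"
      using D by (intro divide_strict_right_mono)
    also have "\<dots> = C * (2 * Re v - 1)" using D by (simp add: v field_simps)
    also have "1 / D = (Re v)\<^sup>2 + (Im v)\<^sup>2"
      using D unfolding v power_divide add_divide_distrib[symmetric] D_def[symmetric]
      by (simp add: power2_eq_square)
    finally show ?thesis using v D that(2) \<open>w \<noteq> 1\<close> by simp
  qed
  note v = disk[OF w(1,3) v_def] and v' = disk[OF w(2,4) v'_def]
  have "(1 - w * w') / ((1 - w)\<^sup>2 * (1 - w')\<^sup>2) = v * v' * (v + v' - 1)" (is "?K = _")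
  proof -
    have e: "1 - w * w' = (1 - w) + (1 - w') - (1 - w) * (1 - w')" by (simp add: algebra_simps)
    have "1 - w \<noteq> 0" "1 - w' \<noteq> 0" using v v' by auto
    then show ?thesis
      unfolding v_def v'_def e by (simp add: divide_simps power2_eq_square)
  qed
  moreover have "Im (v * v' * (v + v' - 1)) = kernel_im (Re v) (Im v) (Re v') (Im v')"
    by (simp add: kernel_im_def algebra_simps)
  ultimately have im: "Im ?K = kernel_im (Re v) (Im v) (Re v') (Im v')" by simp
  show ?thesis
  proof (cases "Im v = 0 \<and> Im v' = 0")
    case False
    then have "0 < Im ?K" unfolding im using v v' by (intro kernel_im_pos[OF C]) auto
    then show ?thesis by (simp add: upper_slit_def)
  next
    \<comment> \<open>Here both arguments are real in (-1, 1), and the kernel is a positive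
      real.\<close>
    case True
    then obtain a b where ab: "w = of_real a" "w' = of_real b"
      using v v' by (metis complex_is_Real_iff Reals_cases)
    have "\<bar>a\<bar> < 1" "\<bar>b\<bar> < 1" using w less_trans[OF _ radius_bounds(1)] by (auto simp: ab)
    then have "\<bar>a * b\<bar> < 1" using abs_mult_less[of a 1 b 1] by (simp add: abs_mult)
    then have "0 < (1 - a * b) / ((1 - a)\<^sup>2 * (1 - b)\<^sup>2)"
      using \<open>\<bar>a\<bar> < 1\<close> \<open>\<bar>b\<bar> < 1\<close> by (intro divide_pos_pos mult_pos_pos) auto
    moreover have "?K = of_real ((1 - a * b) / ((1 - a)\<^sup>2 * (1 - b)\<^sup>2))" by (simp add: ab)
    ultimately show ?thesis by (simp only: upper_slit_def mem_Collect_eq Im_complex_of_real Re_complex_of_real) simp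
  qed
qed

subsection \<open>Mixtures of Koebe functions\<close>

text \<open>For moments \<open>m\<close> of a measure this is the integral of the Koebe functions
  \<open>z / (1 - t * z)\<^sup>2\<close>.\<close>

definition weighted_series :: "(nat \<Rightarrow> real) \<Rightarrow> complex \<Rightarrow> complex" where
  "weighted_series m z = (\<Sum>n. of_real (real (Suc n) * m n) * z ^ Suc n)"

lemma summable_deriv_geometric:
  fixes x :: real
  assumes "\<bar>x\<bar> < 1"
  shows "summable (\<lambda>n. real (Suc n) * x ^ Suc n)"
  using sums_mult[OF geometric_deriv_sums[of x], of x] assms
  by (simp add: sums_iff algebra_simps)

lemma weighted_series_term_bound:
  assumes "0 \<le> m n" "m n \<le> 1"
  shows "norm (of_real (real (Suc n) * m n) * z ^ Suc n :: complex) \<le> real (Suc n) * norm z ^ Suc n"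
proof -
  have "norm (of_real (real (Suc n) * m n) * z ^ Suc n :: complex) = m n * (real (Suc n) * norm z ^ Suc n)"
    using assms unfolding norm_mult norm_of_real norm_power by (simp add: abs_mult)
  also have "\<dots> \<le> 1 * (real (Suc n) * norm z ^ Suc n)"
    using assms by (intro mult_right_mono) auto
  finally show ?thesis by simp
qed

lemma summable_weighted_series:
  assumes "\<And>n. 0 \<le> m n" "\<And>n. m n \<le> 1" "norm z < 1"
  shows "summable (\<lambda>n. of_real (real (Suc n) * m n) * z ^ Suc n :: complex)"
proof (rule summable_comparison_test'[OF summable_deriv_geometric])
  show "\<bar>norm z\<bar> < 1" using assms by simp
  show "norm (of_real (real (Suc n) * m n) * z ^ Suc n :: complex) \<le> real (Suc n) * norm z ^ Suc n" for n
    using weighted_series_term_bound assms by blast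
qed

lemma weighted_series_power:
  assumes "0 \<le> t" "t \<le> 1" "norm z < 1"
  shows "weighted_series (\<lambda>n. t ^ n) z = z / (1 - of_real t * z)\<^sup>2"
proof -
  have "norm (of_real t * z) \<le> 1 * norm z"
    unfolding norm_mult norm_of_real using assms by (intro mult_right_mono) auto
  then have "norm (of_real t * z) < 1" using assms by simp
  from sums_mult[OF geometric_deriv_sums[OF this], of z]
  have "(\<lambda>n. of_real (real (Suc n) * t ^ n) * z ^ Suc n) sums (z / (1 - of_real t * z)\<^sup>2)"
    by (simp add: power_mult_distrib algebra_simps)
  then show ?thesis unfolding weighted_series_def by (rule sums_unique[symmetric])
qed

text \<open>Point masses give points of the curve, and the series is linear in its weights.\<close>

lemma weighted_series_diff_in_hull:
  assumes "norm z < 1" "norm z' < 1" and "f \<in> power_hull"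
  shows "weighted_series f z - weighted_series f z' \<in>
    convex hull (\<lambda>t. z / (1 - of_real t * z)\<^sup>2 - z' / (1 - of_real t * z')\<^sup>2) ` {0..1}"
  using assms(3)
proof (induction rule: power_hull.induct)
  case (power t)
  then show ?case
    using assms by (auto simp: weighted_series_power intro!: hull_inc)
next
  case (mix f g u)
  have mixed: "weighted_series (\<lambda>n. u * f n + (1 - u) * g n) x =
      u *\<^sub>R weighted_series f x + (1 - u) *\<^sub>R weighted_series g x" if "norm x < 1" for x
  proof -
    have "summable (\<lambda>n. of_real (real (Suc n) * f n) * x ^ Suc n)"
      "summable (\<lambda>n. of_real (real (Suc n) * g n) * x ^ Suc n)"
      using summable_weighted_series power_hull_bounds mix(1,2) that by blast+
    note s = this[THEN summable_sums]
    show ?thesis unfolding weighted_series_def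
      using sums_add[OF sums_scaleR_right[OF s(1), of u] sums_scaleR_right[OF s(2), of "1 - u"]]
      by (intro sums_unique[symmetric]) (simp add: scaleR_conv_of_real algebra_simps)
  qed
  have "weighted_series (\<lambda>n. u * f n + (1 - u) * g n) z - weighted_series (\<lambda>n. u * f n + (1 - u) * g n) z' =
    u *\<^sub>R (weighted_series f z - weighted_series f z') +
    (1 - u) *\<^sub>R (weighted_series g z - weighted_series g z')"
    unfolding mixed[OF assms(1)] mixed[OF assms(2)] by (simp add: algebra_simps)
  then show ?case
    using convexD[OF convex_convex_hull mix.IH] mix(3,4) by simp
qed

text \<open>Dominated convergence: all weights lie in [0, 1], so
  \<open>real (Suc n) * norm z ^ Suc n\<close> is a summable bound.\<close>

lemma weighted_series_tendsto:
  assumes h: "\<And>k. h k \<in> power_hull" and lim: "\<And>n. (\<lambda>k. h k n) \<longlonglongrightarrow> m n" and z: "norm z < 1"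
  shows "(\<lambda>k. weighted_series (h k) z) \<longlonglongrightarrow> weighted_series m z"
  unfolding weighted_series_def
proof (rule tannerys_theorem[THEN conjunct2, THEN conjunct2])
  show "(\<lambda>k. of_real (real (Suc n) * h k n) * z ^ Suc n) \<longlonglongrightarrow> of_real (real (Suc n) * m n) * z ^ Suc n" for n
    by (intro tendsto_intros lim)
  show "\<forall>\<^sub>F (n, k) in sequentially \<times>\<^sub>F sequentially.
      norm (of_real (real (Suc n) * h k n) * z ^ Suc n) \<le> real (Suc n) * norm z ^ Suc n"
    using weighted_series_term_bound power_hull_bounds[OF h] by (intro always_eventually) auto
  show "summable (\<lambda>n. real (Suc n) * norm z ^ Suc n)"
    using z by (intro summable_deriv_geometric) simp
qed simp

text \<open>The curve of differences is compact, hence so is its convex hull, which therefore contains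
  the limits of all the finite mixtures.\<close>

lemma weighted_series_neq:
  assumes m: "m \<in> moment_sequences" and z: "norm z < 1" "norm z' < 1"
    and T: "convex T" "0 \<notin> T"
    and sub: "\<And>t. 0 \<le> t \<Longrightarrow> t \<le> 1 \<Longrightarrow> z / (1 - of_real t * z)\<^sup>2 - z' / (1 - of_real t * z')\<^sup>2 \<in> T"
  shows "weighted_series m z \<noteq> weighted_series m z'"
proof -
  let ?D = "\<lambda>t::real. z / (1 - of_real t * z)\<^sup>2 - z' / (1 - of_real t * z')\<^sup>2"
  have nz: "1 - of_real t * x \<noteq> 0" if "norm x < 1" "t \<in> {0..1}" for t :: real and x :: complex
  proof
    assume "1 - of_real t * x = 0"
    then have "1 = norm (of_real t * x)" by simp
    also have "\<dots> \<le> 1 * norm x"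
      unfolding norm_mult norm_of_real using that by (intro mult_right_mono) auto
    finally show False using that by simp
  qed
  have "compact (?D ` {0..1})"
    using nz[OF z(1)] nz[OF z(2)] by (intro compact_continuous_image continuous_intros) auto
  then have closed: "closed (convex hull (?D ` {0..1}))"
    by (intro compact_imp_closed compact_convex_hull)
  from m obtain h where h: "\<And>k. h k \<in> power_hull" and lim: "\<And>n. (\<lambda>k. h k n) \<longlonglongrightarrow> m n"
    unfolding moment_sequences_def by auto
  have "(\<lambda>k. weighted_series (h k) z - weighted_series (h k) z') \<longlonglongrightarrow> weighted_series m z - weighted_series m z'"
    by (intro tendsto_diff weighted_series_tendsto h lim z)
  then have "weighted_series m z - weighted_series m z' \<in> convex hull (?D ` {0..1})"
    by (rule closed_sequentially[OF closed weighted_series_diff_in_hull[OF z h]])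
  moreover have "convex hull (?D ` {0..1}) \<subseteq> T"
    using T(1) sub by (intro hull_minimal) auto
  ultimately show ?thesis using T(2) by auto
qed

section \<open>Separation of pairs of points and injectivity\<close>

lemma weighted_series_cnj:
  assumes "m \<in> moment_sequences" "norm z < 1"
  shows "weighted_series m (cnj z) = cnj (weighted_series m z)"
  using bounded_linear.suminf[OF bounded_linear_cnj summable_weighted_series[of m z]]
    moment_sequences_bounds[OF assms(1)] assms(2)
  unfolding weighted_series_def by simp

lemma weighted_series_neq_upper:
  assumes m: "m \<in> moment_sequences" and "z \<noteq> z'"
    and z: "norm z < sqrt (sqrt 32 - 5)" "norm z' < sqrt (sqrt 32 - 5)" "0 \<le> Im z" "0 \<le> Im z'"
  shows "weighted_series m z \<noteq> weighted_series m z'"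
proof (rule weighted_series_neq[OF m])
  let ?T = "(\<lambda>d. d / (z - z')) -` upper_slit"
  show z1: "norm z < 1" "norm z' < 1" using z radius_bounds(1) by linarith+
  show "convex ?T"
    by (intro convex_linear_vimage convex_upper_slit bounded_linear.linear bounded_linear_divide)
  show "0 \<notin> ?T" by (simp add: upper_slit_def)
  fix t :: real
  assume t: "0 \<le> t" "t \<le> 1"
  let ?w = "of_real t * z" and ?w' = "of_real t * z'"
  have le: "norm ?w \<le> 1 * norm z" "norm ?w' \<le> 1 * norm z'"
    unfolding norm_mult norm_of_real using t by (intro mult_right_mono; simp)+
  then have "norm ?w < 1" "norm ?w' < 1" using z1 by auto
  then have nz: "1 - ?w \<noteq> 0" "1 - ?w' \<noteq> 0" by (metis eq_iff_diff_eq_0 norm_one less_irrefl)+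
  \<comment> \<open>The difference quotient is the kernel at \<open>t * z\<close> and
    \<open>t * z'\<close>, which stay in the half disk.\<close>
  have "z / (1 - ?w)\<^sup>2 - z' / (1 - ?w')\<^sup>2 = (z - z') * ((1 - ?w * ?w') / ((1 - ?w)\<^sup>2 * (1 - ?w')\<^sup>2))"
    using nz by (simp add: divide_simps) (simp add: power2_eq_square algebra_simps)
  moreover have "(1 - ?w * ?w') / ((1 - ?w)\<^sup>2 * (1 - ?w')\<^sup>2) \<in> upper_slit"
    using le z t by (intro kernel_in_upper_slit) auto
  ultimately show "z / (1 - ?w)\<^sup>2 - z' / (1 - ?w')\<^sup>2 \<in> ?T"
    using \<open>z \<noteq> z'\<close> by simp
qed

text \<open>After multiplication by the conjugate denominator, the imaginary part is
  \<open>Im z\<close> times \<open>1 - (t * norm z)\<^sup>2\<close>, up to a positive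
  factor.\<close>

lemma Im_koebe_pos:
  assumes "norm z < 1" "0 < Im z" "0 \<le> t" "t \<le> 1"
  shows "0 < Im (z / (1 - of_real t * z)\<^sup>2)"
proof -
  let ?b = "1 - of_real t * z"
  have "t * norm z \<le> 1 * norm z" using assms by (intro mult_right_mono) auto
  then have tz: "t * norm z < 1" using assms by simp
  have b: "?b \<noteq> 0"
  proof
    assume "?b = 0"
    then have "norm (of_real t * z) = 1" by simp
    then show False using tz assms by (simp add: norm_mult)
  qed
  have "Im (z * cnj (?b\<^sup>2)) = Im z * (1 - (t * norm z)\<^sup>2)"
    unfolding power_mult_distrib cmod_power2 by (simp add: power2_eq_square algebra_simps)
  also have "\<dots> > 0"
    using assms tz by (intro mult_pos_pos) (auto simp: power_less_one_iff)
  finally have "0 < Im (z * cnj (?b\<^sup>2)) / (norm (?b\<^sup>2))\<^sup>2"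
    using b by (intro divide_pos_pos) auto
  also have "\<dots> = Im (z / ?b\<^sup>2)"
    unfolding complex_div_cnj[of z "?b\<^sup>2"] by simp
  finally show ?thesis .
qed

text \<open>The Koebe functions preserve the sign of the imaginary part on the whole unit disk, so
  this case does not restrict the radius.\<close>

lemma weighted_series_neq_opposite:
  assumes m: "m \<in> moment_sequences" and z: "norm z < 1" "norm z' < 1" "0 < Im z" "Im z' < 0"
  shows "weighted_series m z \<noteq> weighted_series m z'"
proof (rule weighted_series_neq[OF m z(1,2), where T = "{d. 0 < Im d}"])
  show "convex {d. 0 < Im d}" by (rule convex_halfspace_Im_gt)
  fix t :: real
  assume t: "0 \<le> t" "t \<le> 1"
  have "cnj z' / (1 - of_real t * cnj z')\<^sup>2 = cnj (z' / (1 - of_real t * z')\<^sup>2)" by simp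
  then have "Im (z' / (1 - of_real t * z')\<^sup>2) < 0"
    using Im_koebe_pos[of "cnj z'" t] z t by (metis complex_cnj complex_mod_cnj complex.sel(2) cnj.sel(2) neg_0_less_iff_less)
  then show "z / (1 - of_real t * z)\<^sup>2 - z' / (1 - of_real t * z')\<^sup>2 \<in> {d. 0 < Im d}"
    using Im_koebe_pos[OF z(1,3) t] by simp
qed simp

lemma inj_on_weighted_series:
  assumes m: "m \<in> moment_sequences"
  shows "inj_on (weighted_series m) (ball 0 (sqrt (sqrt 32 - 5)))"
proof (rule inj_onI, rule ccontr)
  fix z z'
  assume "z \<in> ball 0 (sqrt (sqrt 32 - 5))" "z' \<in> ball 0 (sqrt (sqrt 32 - 5))"
    and eq: "weighted_series m z = weighted_series m z'" and "z \<noteq> z'"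
  then have z: "norm z < sqrt (sqrt 32 - 5)" "norm z' < sqrt (sqrt 32 - 5)" by auto
  then have z1: "norm z < 1" "norm z' < 1" using radius_bounds(1) by linarith+
  consider "0 \<le> Im z" "0 \<le> Im z'" | "Im z \<le> 0" "Im z' \<le> 0" | "0 < Im z" "Im z' < 0" | "Im z < 0" "0 < Im z'"
    by linarith
  then show False
  proof cases
    case 1
    then show ?thesis using weighted_series_neq_upper[OF m \<open>z \<noteq> z'\<close> z] eq by simp
  next
    case 2
    then show ?thesis
      using weighted_series_neq_upper[OF m, of "cnj z" "cnj z'"] z z1 eq \<open>z \<noteq> z'\<close>
      by (simp add: weighted_series_cnj[OF m])
  next
    case 3
    then show ?thesis using weighted_series_neq_opposite[OF m z1] eq by simp
  next
    case 4
    then show ?thesis using weighted_series_neq_opposite[OF m z1(2,1)] eq by simp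
  qed
qed

lemma holomorphic_weighted_series:
  assumes "m \<in> moment_sequences"
  shows "weighted_series m holomorphic_on ball 0 1"
proof -
  \<comment> \<open>A zero constant term is prepended to obtain a power series indexed by its
    exponents.\<close>
  have "(\<lambda>n. (case n of 0 \<Rightarrow> 0 | Suc k \<Rightarrow> of_real (real (Suc k) * m k)) * (z - 0) ^ n) sums weighted_series m z"
    if "z \<in> ball 0 1" for z
  proof -
    have "(\<lambda>n. of_real (real (Suc n) * m n) * z ^ Suc n) sums weighted_series m z"
      unfolding weighted_series_def
      using moment_sequences_bounds[OF assms] that by (intro summable_sums summable_weighted_series) auto
    then show ?thesis
      by (subst (asm) sums_Suc_iff[where f = "\<lambda>n. (case n of 0 \<Rightarrow> 0 | Suc k \<Rightarrow> of_real (real (Suc k) * m k)) * z ^ n", simplified nat.case])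
        simp
  qed
  then show ?thesis by (rule power_series_holomorphic)
qed

section \<open>Hypergeometric coefficients as weighted moments\<close>

lemma foldl_pochhammer:
  fixes c :: complex
  shows "foldl (\<lambda>r x. r * pochhammer x n) c (map complex_of_real xs) =
    c * of_real (\<Prod>i<length xs. pochhammer (xs ! i) n)"
proof (induction xs arbitrary: c)
  case (Cons x xs)
  then show ?case
    by (simp add: pochhammer_of_real prod.lessThan_Suc_shift mult.assoc del: prod.lessThan_Suc)
qed simp

theorem theorem14:
  fixes q :: nat and \<sigma> :: real and A B :: "real list"
  assumes "q \<ge> 1" and "length A = q" and "length B = q"
    and "weakly_supermajorized B A"
    and "0 < \<sigma>" and "\<sigma> \<le> 2"
  shows "univalent_on
           (\<lambda>z. z * hypergeometric (map complex_of_real (\<sigma> # A)) (map complex_of_real B) z)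
           (ball 0 (sqrt (sqrt 32 - 5)))"
proof -
  note maj = assms(4)[unfolded weakly_supermajorized_def]
  \<comment> \<open>Since \<open>pochhammer 2 n = fact (n + 1)\<close>, dividing by it accounts for
    \<open>1 / fact n\<close> and leaves the factor \<open>n + 1\<close> of
    \<open>weighted_series\<close>.\<close>
  define m where "m n = pochhammer \<sigma> n / pochhammer 2 n * (\<Prod>i<q. pochhammer (A ! i) n / pochhammer (B ! i) n)" for n
  have pos: "0 < A ! i" "0 < B ! i" if "i < q" for i
    using maj assms(2,3) that by auto
  have "(\<Sum>i<k. A ! i) \<le> (\<Sum>i<k. B ! i)" if "k \<le> q" for k
    using maj assms(2) that by (cases "k = 0") auto
  then have "(\<lambda>n. \<Prod>i<q. pochhammer (A ! i) n / pochhammer (B ! i) n) \<in> moment_sequences"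
    using maj assms(2,3) pos by (intro pochhammer_quotient_moments) (auto intro: sorted_nth_mono)
  moreover have "(\<lambda>n. pochhammer \<sigma> n / pochhammer 2 n) \<in> moment_sequences"
  proof -
    \<comment> \<open>The pair \<open>\<sigma>\<close>, 2 is treated as weak majorization of length
      one, which is the bound \<open>\<sigma> \<le> 2\<close>.\<close>
    have "(\<Sum>i<k. \<sigma>) \<le> (\<Sum>i<k. 2)" for k :: nat
      using \<open>\<sigma> \<le> 2\<close> by (intro sum_mono) auto
    then show ?thesis
      using pochhammer_quotient_moments[of 1 "\<lambda>_. 2" "\<lambda>_. \<sigma>"] \<open>0 < \<sigma>\<close> by simp
  qed
  ultimately have m: "m \<in> moment_sequences"
    unfolding m_def by (intro moment_sequences_mult)
  have coeff: "fps_nth (fps_hypergeo (map complex_of_real (\<sigma> # A)) (map complex_of_real B) 1) n =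
      of_real (real (Suc n) * m n)" for n
  proof -
    have two: "pochhammer (2::real) n = fact n * real (Suc n)"
      using pochhammer_rec[of "1::real" n] by (simp add: pochhammer_fact[symmetric] algebra_simps)
    have "foldl (\<lambda>r x. r * pochhammer x n) 1 (map complex_of_real (\<sigma> # A)) =
        of_real (pochhammer \<sigma> n * (\<Prod>i<q. pochhammer (A ! i) n))"
      using assms(2) by (simp add: foldl_pochhammer pochhammer_of_real)
    moreover have "foldl (\<lambda>r x. r * pochhammer x n) 1 (map complex_of_real B) =
        of_real (\<Prod>i<q. pochhammer (B ! i) n)"
      using assms(3) by (simp add: foldl_pochhammer)
    ultimately have "fps_nth (fps_hypergeo (map complex_of_real (\<sigma> # A)) (map complex_of_real B) 1) n =
        of_real (pochhammer \<sigma> n * (\<Prod>i<q. pochhammer (A ! i) n) / ((\<Prod>i<q. pochhammer (B ! i) n) * fact n))"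
      unfolding fps_hypergeo_nth by simp
    also have "pochhammer \<sigma> n * (\<Prod>i<q. pochhammer (A ! i) n) / ((\<Prod>i<q. pochhammer (B ! i) n) * fact n) =
        real (Suc n) * m n"
      unfolding m_def two prod_dividef by (simp add: field_simps del: of_nat_Suc)
    finally show ?thesis .
  qed
  \<comment> \<open>The disk lies inside the unit disk, where \<open>hypergeometric\<close> is the
    sum of its series.\<close>
  have eq: "z * hypergeometric (map complex_of_real (\<sigma> # A)) (map complex_of_real B) z = weighted_series m z"
    if "z \<in> ball 0 (sqrt (sqrt 32 - 5))" for z
  proof -
    have z: "norm z < 1" using that less_trans[OF _ radius_bounds(1)] by simp
    have "summable (\<lambda>n. z * (of_real (real (Suc n) * m n) * z ^ n))"
      using summable_weighted_series[of m z] moment_sequences_bounds[OF m] z by (simp add: mult_ac)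
    then have "summable (\<lambda>n. of_real (real (Suc n) * m n) * z ^ n)"
      by (cases "z = 0") (auto simp: summable_cmult_iff)
    then have "z * (\<Sum>n. of_real (real (Suc n) * m n) * z ^ n) = weighted_series m z"
      unfolding weighted_series_def by (subst suminf_mult[symmetric]) (simp_all add: mult_ac)
    then show ?thesis
      using z unfolding hypergeometric_def eval_fps_def coeff by simp
  qed
  have "weighted_series m holomorphic_on ball 0 (sqrt (sqrt 32 - 5))"
    using radius_bounds(1)
    by (intro holomorphic_on_subset[OF holomorphic_weighted_series[OF m]] subset_ball) simp
  then have "(\<lambda>z. z * hypergeometric (map complex_of_real (\<sigma> # A)) (map complex_of_real B) z)
      holomorphic_on ball 0 (sqrt (sqrt 32 - 5))"
    by (rule holomorphic_transform) (rule eq[symmetric])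
  moreover have "inj_on (\<lambda>z. z * hypergeometric (map complex_of_real (\<sigma> # A)) (map complex_of_real B) z)
      (ball 0 (sqrt (sqrt 32 - 5)))"
    by (rule iffD2[OF inj_on_cong inj_on_weighted_series[OF m]]) (rule eq)
  ultimately show ?thesis
    unfolding univalent_on_def by (rule conjI)
qed

end
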